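(* Let $G$ be a torsion-free subgroup of $\mathrm{Homeo}^+(S^1)$. If every nontrivial element of $G$ has at most one fixed point in $S^1$, then $G$ is abelian. Moreover, either $G$ acts freely on $S^1$ or $G$ has a global fixed point.
   Context: $\mathrm{Homeo}^+(S^1)$ denotes the group of orientation-preserving homeomorphisms of the circle $S^1$ under composition. $G$ acts freely if no nontrivial element of $G$ has a fixed point. A global fixed point is a point $p\in S^1$ with $g(p)=p$ for all $g\in G$. *)

theory Defs
  imports "HOL-Analysis.Analysis" "HOL-Algebra.Bij"
begin

abbreviation S1 :: "complex set" where
  "S1 \<equiv> sphere 0 1"

text \<open>
  The angle map \<^term>\<open>cis\<close> is the universal covering of the circle by the line, with period
  \<^term>\<open>2 * pi\<close>. A homeomorphism of the circle preserves orientation if it lifts to an increasing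
  continuous map of the line that commutes with the translation by the period.
\<close>

definition orientation_preserving :: "(complex \<Rightarrow> complex) \<Rightarrow> bool" where
  "orientation_preserving f \<longleftrightarrow>
     (\<exists>F::real \<Rightarrow> real. continuous_on UNIV F \<and> strict_mono F \<and>
        (\<forall>t. F (t + 2 * pi) = F t + 2 * pi) \<and>
        (\<forall>t. f (cis t) = cis (F t)))"

text \<open>
  Membership in \<^term>\<open>Bij S1\<close> makes a map take the value \<^term>\<open>undefined\<close> off the circle, so that
  equality of elements is equality of maps on the circle.
\<close>

definition Homeo_plus_S1 :: "(complex \<Rightarrow> complex) monoid" where
  "Homeo_plus_S1 = BijGroup S1
     \<lparr>carrier := {f \<in> Bij S1. (\<exists>g. homeomorphism S1 S1 f g) \<and> orientation_preserving f}\<rparr>"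

definition torsion_free :: "('a, 'b) monoid_scheme \<Rightarrow> bool" where
  "torsion_free G \<longleftrightarrow>
     (\<forall>x\<in>carrier G. x \<noteq> \<one>\<^bsub>G\<^esub> \<longrightarrow> (\<forall>n::nat. n > 0 \<longrightarrow> x [^]\<^bsub>G\<^esub> n \<noteq> \<one>\<^bsub>G\<^esub>))"

definition acts_freely :: "(complex \<Rightarrow> complex) set \<Rightarrow> bool" where
  "acts_freely G \<longleftrightarrow> (\<forall>g\<in>G. g \<noteq> \<one>\<^bsub>Homeo_plus_S1\<^esub> \<longrightarrow> \<not> (\<exists>p\<in>S1. g p = p))"

definition has_global_fixed_point :: "(complex \<Rightarrow> complex) set \<Rightarrow> bool" where
  "has_global_fixed_point G \<longleftrightarrow> (\<exists>p\<in>S1. \<forall>g\<in>G. g p = p)"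

lemma S1_eq_range_cis: "S1 = range cis"
proof -
  have "z \<in> range cis" if "norm z = 1" for z
    using that by (metis cis_Arg norm_zero rangeI sgn_div_norm div_by_1 scaleR_one inverse_1 zero_neq_one)
  then show ?thesis by auto
qed

lemma one_Homeo_plus_S1: "\<one>\<^bsub>Homeo_plus_S1\<^esub> = (\<lambda>z\<in>S1. z)"
  by (simp add: Homeo_plus_S1_def BijGroup_def)

lemma lift_surj:
  fixes F :: "real \<Rightarrow> real"
  assumes cont: "continuous_on UNIV F" and per: "\<And>t. F (t + 2 * pi) = F t + 2 * pi"
  shows "surj F"
proof -
  have up: "F (real n * (2 * pi)) = F 0 + real n * (2 * pi)" for n
  proof (induction n)
    case (Suc n)
    show ?case using per[of "real n * (2 * pi)"] Suc by (simp add: algebra_simps)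
  qed simp
  have down: "F (- (real n * (2 * pi))) = F 0 - real n * (2 * pi)" for n
  proof (induction n)
    case (Suc n)
    show ?case using per[of "- (real (Suc n) * (2 * pi))"] Suc by (simp add: algebra_simps)
  qed simp
  have "\<exists>x. F x = y" for y
  proof -
    obtain n where n: "\<bar>y - F 0\<bar> < real n * (2 * pi)"
      using reals_Archimedean3[of "2 * pi"] by auto
    have "\<exists>x\<ge>- (real n * (2 * pi)). x \<le> real n * (2 * pi) \<and> F x = y"
    proof (rule IVT')
      show "F (- (real n * (2 * pi))) \<le> y" using down[of n] n by linarith
      show "y \<le> F (real n * (2 * pi))" using up[of n] n by linarith
      show "- (real n * (2 * pi)) \<le> real n * (2 * pi)" using n by linarith
      show "continuous_on {- (real n * (2 * pi))..real n * (2 * pi)} F"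
        using cont continuous_on_subset by blast
    qed
    then show ?thesis by blast
  qed
  then show ?thesis by (metis surjI)
qed

lemma subgroup_orientation_preserving:
  "subgroup {f \<in> Bij S1. (\<exists>g. homeomorphism S1 S1 f g) \<and> orientation_preserving f} (BijGroup S1)"
  (is "subgroup ?H _")
proof (rule group.subgroupI[OF group_BijGroup])
  have id: "(\<lambda>z\<in>S1. z) \<in> ?H"
  proof -
    have "homeomorphism S1 S1 (\<lambda>z\<in>S1. z) (\<lambda>z. z)"
      by (auto simp: homeomorphism_def image_iff intro: continuous_on_eq[of _ "\<lambda>z. z"])
    moreover have "orientation_preserving (\<lambda>z\<in>S1. z)"
      unfolding orientation_preserving_def
      by (rule exI[of _ "\<lambda>t. t"]) (auto simp: strict_mono_def)
    ultimately show ?thesis using id_Bij[of S1] by blast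
  qed
  show "?H \<subseteq> carrier (BijGroup S1)" by (auto simp: BijGroup_def)
  show "?H \<noteq> {}" using id by blast
next
  fix f assume f: "f \<in> ?H"
  then obtain g F where fB: "f \<in> Bij S1" and g: "homeomorphism S1 S1 f g"
    and F: "continuous_on UNIV F" "strict_mono F" "\<And>t. F (t + 2 * pi) = F t + 2 * pi"
      "\<And>t. f (cis t) = cis (F t)"
    unfolding orientation_preserving_def by blast
  have inj: "inj_on f S1" using fB by (auto simp: Bij_def bij_betw_def)
  let ?g = "\<lambda>z\<in>S1. inv_into S1 f z"
  have gg: "?g z = g z" if "z \<in> S1" for z
    using that g inj unfolding homeomorphism_def
    by (metis image_eqI inv_into_f_f restrict_apply')
  have "homeomorphism S1 S1 ?g f"
    using homeomorphism_symD[OF g] by (rule homeomorphism_cong) (use gg in \<open>simp_all del: mem_sphere_0 mem_sphere restrict_apply\<close>)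
  moreover have "orientation_preserving ?g"
  proof -
    have s: "surj F" using lift_surj F by blast
    have i: "inj F" using F(2) strict_mono_imp_inj_on by blast
    let ?F = "inv_into UNIV F"
    have FF: "F (?F t) = t" "?F (F t) = t" for t using s i by (simp_all add: surj_f_inv_f)
    have sm: "strict_mono ?F"
      using F(2) FF by (metis strict_mono_def strict_mono_less)
    have "continuous_on UNIV ?F"
    proof (rule continuous_onI_mono)
      have "range ?F = UNIV" using FF by (metis surjI)
      then show "open (range ?F)" by simp
      show "?F x \<le> ?F y" if "x \<le> y" for x y using that sm by (simp add: strict_mono_less_eq)
    qed
    moreover have "?F (t + 2 * pi) = ?F t + 2 * pi" for t
      by (metis F(3) FF)
    moreover have "?g (cis t) = cis (?F t)" for t
    proof -
      have "f (cis (?F t)) = cis t" by (simp add: F(4) FF)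
      then show ?thesis using inj by (metis S1_eq_range_cis inv_into_f_f rangeI restrict_apply')
    qed
    ultimately show ?thesis using sm unfolding orientation_preserving_def by blast
  qed
  moreover have "?g \<in> Bij S1" using fB by (rule restrict_inv_into_Bij)
  ultimately show "inv\<^bsub>BijGroup S1\<^esub> f \<in> ?H" using fB by (auto simp: inv_BijGroup)
next
  fix f h assume f: "f \<in> ?H" and h: "h \<in> ?H"
  obtain f' F where f': "homeomorphism S1 S1 f f'"
    and F: "continuous_on UNIV F" "strict_mono F" "\<And>t. F (t + 2 * pi) = F t + 2 * pi"
      "\<And>t. f (cis t) = cis (F t)"
    using f unfolding orientation_preserving_def by blast
  obtain h' H where h': "homeomorphism S1 S1 h h'"
    and H: "continuous_on UNIV H" "strict_mono H" "\<And>t. H (t + 2 * pi) = H t + 2 * pi"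
      "\<And>t. h (cis t) = cis (H t)"
    using h unfolding orientation_preserving_def by blast
  have "homeomorphism S1 S1 (compose S1 f h) (h' \<circ> f')"
    using homeomorphism_compose[OF h' f']
    by (rule homeomorphism_cong) (auto simp: compose_def)
  moreover have "orientation_preserving (compose S1 f h)"
    unfolding orientation_preserving_def
  proof (intro exI conjI allI)
    show "continuous_on UNIV (F \<circ> H)"
      using F(1) H(1) by (meson continuous_on_compose continuous_on_subset subset_UNIV)
    show "strict_mono (F \<circ> H)" using F(2) H(2) by (simp add: strict_mono_def)
    show "(F \<circ> H) (t + 2 * pi) = (F \<circ> H) t + 2 * pi" for t by (simp add: F(3) H(3))
    show "compose S1 f h (cis t) = cis ((F \<circ> H) t)" for t by (simp add: compose_def F(4) H(4))
  qed
  moreover have "compose S1 f h \<in> Bij S1" using f h by (simp add: compose_Bij)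
  ultimately show "f \<otimes>\<^bsub>BijGroup S1\<^esub> h \<in> ?H" using f h by (auto simp: BijGroup_def)
qed

lemma group_Homeo_plus_S1: "group Homeo_plus_S1"
  unfolding Homeo_plus_S1_def
  by (rule subgroup.subgroup_is_group[OF subgroup_orientation_preserving group_BijGroup])

end

theory Submission
  imports Defs
begin

text \<open>
  Suppose that a nontrivial $f$ in $G$ fixes $p$ while some $g$ in $G$ moves $p$ to another point $q$.
  Cut the circle open at $p$: as $f$ has no other fixed point, its lift $F$ through the fixed point
  lies on one side of the diagonal away from the lifts of $p$, say above it. The conjugate
  $h = g f g^{-1}$ fixes $q$ only, and it has a lift $H$ that lies above the diagonal away from the
  lifts of $q$, because increasing maps conjugate upward motion to upward motion. Hence $F < H$ at $p$
  and $H < F$ at $q$; over one period the graphs cross at least twice, so that $h^{-1} f$ fixes two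
  points of the circle. Then $f = h$, which fixes both $p$ and $q$, a contradiction. So a fixed point
  of one nontrivial element is fixed by all of $G$ (lemma \<open>fixed_point_is_global\<close>), and the action is
  free or has a global fixed point.
  
  In both cases $G$ lifts to a group of increasing maps of the line that acts freely on an interval.
  If $G$ acts freely, these are all the lifts of all the elements, acting on the whole line. If $G$
  fixes the point at angle $a$, these are the lifts that fix $a$, acting on the open interval from $a$
  to $a + 2\pi$. A group of this kind is commutative by Hoelder's argument (theorem \<open>commute\<close>):
  freeness makes the pointwise order of maps total, continuity makes it Archimedean, and an
  Archimedean ordered group is commutative.
\<close>

section \<open>Hoelder's theorem for groups of increasing maps of an interval\<close>

text \<open>
  The maps in $L$ are increasing bijections of the whole line, but freeness is required on $I$ only:
  lifts that fix a point $a$ also fix $a + 2k\pi$. Equality in the conclusion of \<open>free\<close> is equality on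
  the whole line, so that an element of $L$ is determined by its value at one point of $I$.
\<close>

locale free_interval_action =
  fixes L :: "(real \<Rightarrow> real) set" and I :: "real set"
  assumes interval: "is_interval I" and nonempty: "I \<noteq> {}"
    and id_mem: "id \<in> L"
    and comp_mem: "\<And>F H. F \<in> L \<Longrightarrow> H \<in> L \<Longrightarrow> F \<circ> H \<in> L"
    and inverse_mem: "\<And>F. F \<in> L \<Longrightarrow> \<exists>K\<in>L. K \<circ> F = id \<and> F \<circ> K = id"
    and cont: "\<And>F. F \<in> L \<Longrightarrow> continuous_on I F"
    and mono: "\<And>F. F \<in> L \<Longrightarrow> strict_mono F"
    and maps: "\<And>F x. F \<in> L \<Longrightarrow> x \<in> I \<Longrightarrow> F x \<in> I"
    and free: "\<And>F x. F \<in> L \<Longrightarrow> x \<in> I \<Longrightarrow> F x = x \<Longrightarrow> F = id"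
begin

definition below :: "(real \<Rightarrow> real) \<Rightarrow> (real \<Rightarrow> real) \<Rightarrow> bool"  (infix "\<lless>" 50) where
  "F \<lless> H \<longleftrightarrow> (\<forall>x\<in>I. F x < H x)"

lemma eq_of_agree:
  assumes "F \<in> L" "H \<in> L" "x \<in> I" "F x = H x"
  shows "F = H"
proof -
  obtain K where K: "K \<in> L" "K \<circ> H = id" "H \<circ> K = id" using inverse_mem assms by blast
  have "(K \<circ> F) x = x" using K(2) assms(4) by (metis comp_apply id_apply)
  then have "K \<circ> F = id" using free comp_mem K(1) assms by blast
  then show ?thesis using K(3) by (metis comp_assoc comp_id id_comp)
qed

text \<open>
  Two continuous functions that do not agree anywhere on a connected set are ordered in the same way
  at all of its points.
\<close>

lemma trichotomy:
  assumes "F \<in> L" "H \<in> L"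
  shows "F = H \<or> F \<lless> H \<or> H \<lless> F"
proof (rule ccontr)
  assume neg: "\<not> ?thesis"
  let ?D = "\<lambda>x. H x - F x"
  have "connected (?D ` I)"
    using assms cont interval
    by (intro connected_continuous_image continuous_intros) (auto simp: is_interval_connected)
  then have int: "is_interval (?D ` I)" by (simp add: is_interval_connected_1)
  obtain x y where "x \<in> I" "y \<in> I" "?D x \<le> 0" "?D y \<ge> 0"
    using neg unfolding below_def by (force simp: not_less)
  then have "0 \<in> ?D ` I" using int unfolding is_interval_1 by blast
  then obtain z where "z \<in> I" "F z = H z" by force
  then show False using eq_of_agree[OF assms] neg by blast
qed

lemma below_iff_at:
  assumes "F \<in> L" "H \<in> L" "x \<in> I"
  shows "F \<lless> H \<longleftrightarrow> F x < H x"
  using trichotomy[OF assms(1,2)] assms(3) unfolding below_def by force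

lemma funpow_mem: "F \<in> L \<Longrightarrow> F ^^ n \<in> L"
  by (induction n) (simp_all add: id_mem comp_mem)

text \<open>
  A bounded orbit of \<^term>\<open>F\<close> would increase to a limit inside \<^term>\<open>I\<close>, and this limit would be a fixed
  point.
\<close>

lemma archimedean:
  assumes F: "F \<in> L" "id \<lless> F" and x: "x \<in> I" and y: "y \<in> I"
  shows "\<exists>n. y < (F ^^ n) x"
proof (rule ccontr)
  assume "\<nexists>n. y < (F ^^ n) x"
  then have bd: "(F ^^ n) x \<le> y" for n by (meson not_less)
  let ?u = "\<lambda>n. (F ^^ n) x"
  have inI: "?u n \<in> I" for n using funpow_mem[OF F(1)] maps x by blast
  have inc: "incseq ?u"
    using F(2) inI by (intro incseq_SucI) (auto simp: below_def intro: less_imp_le)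
  have "\<forall>n. ?u n \<le> y" using bd by simp
  then obtain s where s: "?u \<longlonglongrightarrow> s" and le: "\<forall>n. ?u n \<le> s"
    by (rule incseq_convergent[OF inc])
  have "s \<le> y" using s bd by (intro LIMSEQ_le_const2) auto
  moreover have "x \<le> s" using le[rule_format, of 0] by simp
  ultimately have sI: "s \<in> I" using mem_is_interval_1_I[OF interval x y] by blast
  have "(\<lambda>n. F (?u n)) \<longlonglongrightarrow> F s"
    using cont[OF F(1)] s sI inI by (auto intro: continuous_on_tendsto_compose)
  moreover have "(\<lambda>n. F (?u n)) \<longlonglongrightarrow> s"
    using LIMSEQ_Suc[OF s] by simp
  ultimately have "F s = s" using LIMSEQ_unique by blast
  then show False using F(2) sI unfolding below_def by force
qed

text \<open>
  The Archimedean property as division with remainder: powers of \<^term>\<open>D\<close> serve as a yardstick for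
  positive elements.
\<close>

lemma between_powers:
  assumes D: "D \<in> L" "id \<lless> D" and F: "F \<in> L" "id \<lless> F"
  obtains m where "\<And>x. x \<in> I \<Longrightarrow> (D ^^ m) x \<le> F x" "F \<lless> D ^^ Suc m"
proof -
  obtain x where x: "x \<in> I" using nonempty by blast
  let ?P = "\<lambda>n. F x < (D ^^ n) x"
  define n where "n = (LEAST n. ?P n)"
  have n: "?P n" unfolding n_def
    using archimedean[OF D x maps[OF F(1) x]] by (rule LeastI_ex)
  have "n \<noteq> 0" using n F(2) x unfolding below_def by (cases n) force+
  then obtain m where m: "n = Suc m" using not0_implies_Suc by blast
  then have "\<not> ?P m" unfolding n_def using not_less_Least lessI by metis
  then have "\<not> F \<lless> D ^^ m" using x unfolding below_def by blast
  then have "(D ^^ m) z \<le> F z" if "z \<in> I" for z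
    using trichotomy[OF F(1) funpow_mem[OF D(1), of m]] that unfolding below_def by force
  moreover have "F \<lless> D ^^ Suc m"
    using below_iff_at[OF F(1) funpow_mem[OF D(1)] x] n m by blast
  ultimately show thesis by (rule that)
qed

text \<open>
  The remainder of \<^term>\<open>F\<close> after division by \<^term>\<open>D\<close> is smaller than \<^term>\<open>D\<close>, hence trivial if
  \<^term>\<open>D\<close> is the least positive element.
\<close>

lemma eq_power_of_least:
  assumes D: "D \<in> L" "id \<lless> D" and least: "\<And>E. E \<in> L \<Longrightarrow> id \<lless> E \<Longrightarrow> \<not> E \<lless> D"
    and F: "F \<in> L" "id \<lless> F"
  shows "\<exists>m. F = D ^^ m"
proof -
  obtain m where m: "\<And>x. x \<in> I \<Longrightarrow> (D ^^ m) x \<le> F x" "F \<lless> D ^^ Suc m"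
    using between_powers[OF D F] by blast
  obtain K where K: "K \<in> L" "K \<circ> (D ^^ m) = id" "(D ^^ m) \<circ> K = id"
    using inverse_mem[OF funpow_mem[OF D(1)]] by blast
  have KD: "K ((D ^^ m) z) = z" "(D ^^ m) (K z) = z" for z
    using K by (metis comp_apply id_apply)+
  let ?E = "K \<circ> F"
  have E: "?E \<in> L" using K F comp_mem by blast
  have "?E \<lless> D"
    unfolding below_def
  proof
    fix x assume "x \<in> I"
    then have "F x < (D ^^ m) (D x)"
      using m(2) unfolding below_def by (simp add: funpow_swap1)
    then have "K (F x) < K ((D ^^ m) (D x))" using mono[OF K(1)] by (simp add: strict_mono_less)
    then show "?E x < D x" by (simp add: KD)
  qed
  then have "\<not> id \<lless> ?E" using least E by blast
  obtain x where x: "x \<in> I" using nonempty by blast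
  have "K ((D ^^ m) x) \<le> K (F x)" using m(1)[OF x] mono[OF K(1)] by (simp add: strict_mono_less_eq)
  then have "?E x = x" using below_iff_at[OF id_mem E x] \<open>\<not> id \<lless> ?E\<close> by (simp add: KD)
  then have "(D ^^ m) x = F x" using KD(2) by (metis comp_apply)
  then show ?thesis using eq_of_agree[OF F(1) funpow_mem[OF D(1)] x] by metis
qed

text \<open>
  If \<^term>\<open>E\<close> lies strictly between the identity and \<^term>\<open>C\<close>, then $C$ is the product of the two
  positive elements $E$ and $E^{-1} C$, and the smaller of the two has a square that does not exceed
  \<^term>\<open>C\<close>.
\<close>

lemma square_root_below:
  assumes nl: "\<And>D. D \<in> L \<Longrightarrow> id \<lless> D \<Longrightarrow> \<exists>E\<in>L. id \<lless> E \<and> E \<lless> D"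
    and C: "C \<in> L" "id \<lless> C"
  obtains D where "D \<in> L" "id \<lless> D" "\<not> C \<lless> D \<circ> D"
proof -
  obtain E where E: "E \<in> L" "id \<lless> E" "E \<lless> C" using nl C by blast
  show thesis
  proof (cases "C \<lless> E \<circ> E")
    case False then show thesis using that E by blast
  next
    case True
    obtain K where K: "K \<in> L" "K \<circ> E = id" "E \<circ> K = id" using inverse_mem[OF E(1)] by blast
    have KE: "K (E z) = z" "E (K z) = z" for z using K by (metis comp_apply id_apply)+
    let ?D = "K \<circ> C"
    have less: "K a < K b \<longleftrightarrow> a < b" for a b using mono[OF K(1)] by (simp add: strict_mono_less)
    have "id \<lless> ?D" using E(3) less unfolding below_def by (metis KE(1) comp_apply id_apply)
    moreover have "(?D \<circ> ?D) x < C x" if x: "x \<in> I" for x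
    proof -
      have y: "K (C x) \<in> I" using maps K(1) C(1) x by blast
      have "C (K (C x)) < E (E (K (C x)))" using True y unfolding below_def by simp
      then have "K (C (K (C x))) < K (E (E (K (C x))))" by (simp only: less)
      then show ?thesis by (simp add: KE)
    qed
    ultimately show thesis
      using that[of ?D] comp_mem[OF K(1) C(1)] nonempty unfolding below_def
      by (meson all_not_in_conv less_asym)
  qed
qed

text \<open>
  If there is a least positive element $D$, then $A$ and $B$ are powers of it. Otherwise a positive
  commutator $C = A B (B A)^{-1}$ admits a positive $D$ with $D^2 \le C$. From
  $D^m \le A < D^{m+1}$ and $D^n \le B < D^{n+1}$ follow $A B < D^{m+n+2}$ and $B A \ge D^{m+n}$, so
  that $C < D^2$, a contradiction.
\<close>

lemma not_positive_commutator:
  assumes A: "A \<in> L" "id \<lless> A" and B: "B \<in> L" "id \<lless> B"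
  shows "\<not> B \<circ> A \<lless> A \<circ> B"
proof
  assume lt: "B \<circ> A \<lless> A \<circ> B"
  show False
  proof (cases "\<exists>D\<in>L. id \<lless> D \<and> (\<forall>E\<in>L. id \<lless> E \<longrightarrow> \<not> E \<lless> D)")
    case True
    then obtain D where "D \<in> L" "id \<lless> D" "\<And>E. E \<in> L \<Longrightarrow> id \<lless> E \<Longrightarrow> \<not> E \<lless> D" by blast
    then obtain m n where "A = D ^^ m" "B = D ^^ n" using eq_power_of_least A B by metis
    then have "A \<circ> B = B \<circ> A" by (simp add: funpow_add[symmetric] add.commute)
    then show False using lt nonempty unfolding below_def by auto
  next
    case False
    obtain K where K: "K \<in> L" "K \<circ> (B \<circ> A) = id" "(B \<circ> A) \<circ> K = id"
      using inverse_mem[OF comp_mem[OF B(1) A(1)]] by blast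
    have KE: "K (B (A z)) = z" "B (A (K z)) = z" for z using K by (metis comp_apply id_apply)+
    let ?C = "(A \<circ> B) \<circ> K"
    have C: "?C \<in> L" using comp_mem A B K by blast
    have "id \<lless> ?C" unfolding below_def
    proof
      fix x assume "x \<in> I"
      then have "K x \<in> I" using maps K by blast
      then have "B (A (K x)) < A (B (K x))" using lt unfolding below_def by simp
      then show "id x < ?C x" by (simp add: KE)
    qed
    then obtain D where D: "D \<in> L" "id \<lless> D" and nD: "\<not> ?C \<lless> D \<circ> D"
      using square_root_below[of ?C] C False by blast
    obtain m where m: "\<And>x. x \<in> I \<Longrightarrow> (D ^^ m) x \<le> A x" "A \<lless> D ^^ Suc m"
      using between_powers[OF D A] by blast
    obtain n where n: "\<And>x. x \<in> I \<Longrightarrow> (D ^^ n) x \<le> B x" "B \<lless> D ^^ Suc n"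
      using between_powers[OF D B] by blast
    have "?C x < (D \<circ> D) x" if x: "x \<in> I" for x
    proof -
      have y: "K x \<in> I" using maps K(1) x by blast
      have DI: "(D ^^ k) (K x) \<in> I" for k using funpow_mem[OF D(1)] maps y by blast
      have "A (B (K x)) < A ((D ^^ Suc n) (K x))"
        using n(2) y mono[OF A(1)] unfolding below_def by (simp add: strict_mono_less)
      also have "\<dots> < (D ^^ Suc m) ((D ^^ Suc n) (K x))"
        using m(2) DI unfolding below_def by blast
      also have "\<dots> = (D ^^ (Suc m + Suc n)) (K x)" by (simp only: funpow_add comp_apply)
      also have "\<dots> = (D ^^ (2 + (n + m))) (K x)" by (simp add: add.commute)
      also have "\<dots> = D (D ((D ^^ n) ((D ^^ m) (K x))))" by (simp add: funpow_add)
      also have "\<dots> \<le> D (D ((D ^^ n) (A (K x))))"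
        using m(1)[OF y] mono[OF D(1)] mono[OF funpow_mem[OF D(1)], of n]
        by (simp add: strict_mono_less_eq)
      also have "\<dots> \<le> D (D (B (A (K x))))"
        using n(1)[OF maps[OF A(1) y]] mono[OF D(1)] by (simp add: strict_mono_less_eq)
      also have "\<dots> = D (D x)" by (simp add: KE)
      finally show ?thesis by simp
    qed
    then show False using nD unfolding below_def by blast
  qed
qed

text \<open>
  An Archimedean ordered group is commutative. Positive elements commute, since neither order of the
  two products can be the larger one; negative elements are replaced by their inverses.
\<close>

theorem commute:
  assumes A: "A \<in> L" and B: "B \<in> L"
  shows "A \<circ> B = B \<circ> A"
proof -
  have pos: "F \<circ> H = H \<circ> F" if "F \<in> L" "H \<in> L" "id \<lless> F" "id \<lless> H" for F H
    using trichotomy[OF comp_mem[OF that(1,2)] comp_mem[OF that(2,1)]]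
      not_positive_commutator[OF that(1,3,2,4)] not_positive_commutator[OF that(2,4,1,3)] by blast
  have inverse_commute: "F \<circ> H = H \<circ> F" if "K \<circ> F = id" "F \<circ> K = id" "K \<circ> H = H \<circ> K"
    for F H K :: "real \<Rightarrow> real"
  proof
    fix x
    have KF: "K (F z) = z" "F (K z) = z" "K (H z) = H (K z)" for z
      using that by (metis comp_apply id_apply)+
    have "F (K (H (F x))) = F (H (K (F x)))" by (simp only: KF(3))
    then show "(F \<circ> H) x = (H \<circ> F) x" by (simp only: KF(1,2) comp_apply)
  qed
  have flip: "F = id \<or> id \<lless> F \<or> (\<exists>K\<in>L. id \<lless> K \<and> K \<circ> F = id \<and> F \<circ> K = id)" if F: "F \<in> L" for F
  proof -
    obtain K where K: "K \<in> L" "K \<circ> F = id" "F \<circ> K = id" using inverse_mem[OF F] by blast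
    have "id \<lless> K" if "F \<lless> id"
      unfolding below_def
    proof
      fix x assume "x \<in> I"
      then have "F (K x) < K x" using that maps K(1) unfolding below_def by auto
      then show "id x < K x" using K(3) by (metis comp_apply id_apply)
    qed
    then show ?thesis using trichotomy[OF F id_mem] K by blast
  qed
  have half: "F \<circ> H = H \<circ> F" if F: "F \<in> L" "id \<lless> F" and H: "H \<in> L" for F H
    using flip[OF H]
  proof (elim disjE bexE conjE)
    fix K assume K: "K \<in> L" "id \<lless> K" "K \<circ> H = id" "H \<circ> K = id"
    show ?thesis using inverse_commute[OF K(3,4) pos[OF K(1) F(1) K(2) F(2)]] by simp
  qed (use pos F H in simp_all)
  show ?thesis
    using flip[OF A]
  proof (elim disjE bexE conjE)
    fix K assume K: "K \<in> L" "id \<lless> K" "K \<circ> A = id" "A \<circ> K = id"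
    show ?thesis by (rule inverse_commute[OF K(3,4) half[OF K(1,2) B]])
  qed (use half A B in simp_all)
qed

end


section \<open>Lifts to the line\<close>

definition is_lift :: "(real \<Rightarrow> real) \<Rightarrow> (complex \<Rightarrow> complex) \<Rightarrow> bool" where
  "is_lift F f \<longleftrightarrow> continuous_on UNIV F \<and> strict_mono F \<and>
     (\<forall>t. F (t + 2 * pi) = F t + 2 * pi) \<and> (\<forall>t. f (cis t) = cis (F t))"

lemma cis_eq_cis_iff: "cis s = cis t \<longleftrightarrow> (\<exists>k::int. s = t + of_int k * (2 * pi))"
proof -
  have "cis s = cis t \<longleftrightarrow> sin s = sin t \<and> cos s = cos t" by (auto simp: complex_eq_iff)
  then show ?thesis by (simp add: sin_cos_eq_iff algebra_simps)
qed

lemma cis_neq_cis: "s < t \<Longrightarrow> t < s + 2 * pi \<Longrightarrow> cis s \<noteq> cis t"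
proof
  assume st: "s < t" "t < s + 2 * pi" and "cis s = cis t"
  then obtain k :: int where k: "t = s + of_int k * (2 * pi)" using cis_eq_cis_iff by metis
  then have "0 < of_int k * (2 * pi)" "of_int k * (2 * pi) < 1 * (2 * pi)" using st by simp_all
  then have "0 < real_of_int k" "real_of_int k < 1"
    using pi_gt_zero by (simp_all add: zero_less_mult_iff mult_less_cancel_right_pos)
  then show False by simp
qed

lemma obtain_translate:
  obtains k :: int where "a \<le> t + of_int k * (2 * pi)" "t + of_int k * (2 * pi) < a + 2 * pi"
proof
  let ?q = "(t - a) / (2 * pi)"
  let ?k = "- \<lfloor>?q\<rfloor>"
  have q: "t - a = ?q * (2 * pi)" by simp
  have "of_int \<lfloor>?q\<rfloor> * (2 * pi) \<le> ?q * (2 * pi)" by (intro mult_right_mono) simp_all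
  then show "a \<le> t + of_int ?k * (2 * pi)" using q by simp
  have "?q * (2 * pi) < (of_int \<lfloor>?q\<rfloor> + 1) * (2 * pi)"
    by (intro mult_strict_right_mono) (linarith, simp)
  then show "t + of_int ?k * (2 * pi) < a + 2 * pi" using q by (simp add: algebra_simps)
qed

lemma lift_translate:
  assumes "is_lift F f"
  shows "F (t + of_int k * (2 * pi)) = F t + of_int k * (2 * pi)"
proof -
  have per: "F (s + 2 * pi) = F s + 2 * pi" for s using assms unfolding is_lift_def by blast
  have nat: "F (s + of_nat n * (2 * pi)) = F s + of_nat n * (2 * pi)" for s n
  proof (induction n)
    case (Suc n)
    show ?case using per[of "s + of_nat n * (2 * pi)"] Suc by (simp add: algebra_simps)
  qed simp
  show ?thesis
  proof (cases k)
    case (nonneg n) then show ?thesis using nat by simp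
  next
    case (neg n)
    then have k: "real_of_int k = - of_nat (Suc n)" by (simp only: of_int_minus of_int_of_nat_eq)
    have "F t = F (t - of_nat (Suc n) * (2 * pi)) + of_nat (Suc n) * (2 * pi)"
      using nat[of "t - of_nat (Suc n) * (2 * pi)" "Suc n"] by (simp only: diff_add_cancel)
    then show ?thesis unfolding k by (simp only: mult_minus_left add_uminus_conv_diff)
  qed
qed

text \<open>
  Two lifts of the same map differ by multiples of the period. On the period that starts at a point of
  agreement both have their values in the same half-open interval of that length, so they agree there.
\<close>

lemma lift_unique:
  assumes F: "is_lift F f" and H: "is_lift H f" and eq: "F x = H x"
  shows "F = H"
proof
  fix t
  obtain k :: int where k: "x \<le> t + of_int k * (2 * pi)" "t + of_int k * (2 * pi) < x + 2 * pi"
    by (rule obtain_translate)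
  let ?s = "t + of_int k * (2 * pi)"
  have range: "J x \<le> J ?s \<and> J ?s < J x + 2 * pi" if "is_lift J f" for J
  proof -
    have "strict_mono J" "J (x + 2 * pi) = J x + 2 * pi" using that unfolding is_lift_def by blast+
    then show ?thesis using k by (metis strict_mono_less strict_mono_less_eq)
  qed
  have c: "cis (F ?s) = cis (H ?s)" using F H unfolding is_lift_def by metis
  have "F ?s = H ?s"
    using cis_neq_cis[of "F ?s" "H ?s"] cis_neq_cis[of "H ?s" "F ?s"] c eq range[OF F] range[OF H]
    by argo
  then show "F t = H t" using lift_translate[OF F] lift_translate[OF H] by simp
qed

lemma lift_shift:
  assumes "is_lift F f"
  shows "is_lift (\<lambda>t. F t + of_int k * (2 * pi)) f"
proof -
  have "cis (y + of_int k * (2 * pi)) = cis y" for y unfolding cis_eq_cis_iff by blast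
  moreover have "continuous_on UNIV (\<lambda>t. F t + of_int k * (2 * pi))"
    using assms unfolding is_lift_def by (intro continuous_on_add continuous_on_const) blast
  ultimately show ?thesis
    using assms unfolding is_lift_def by (simp only: strict_mono_def) simp
qed

lemma lift_through:
  assumes "orientation_preserving f" and "f (cis x) = cis y"
  obtains F where "is_lift F f" "F x = y"
proof -
  obtain F where F: "is_lift F f" using assms(1) unfolding orientation_preserving_def is_lift_def by blast
  then have "cis y = cis (F x)" using assms(2) unfolding is_lift_def by metis
  then obtain k :: int where "y = F x + of_int k * (2 * pi)" using cis_eq_cis_iff by blast
  then show thesis using that lift_shift[OF F] by metis
qed


section \<open>Subgroups of the homeomorphism group\<close>

locale circle_group =
  fixes G :: "(complex \<Rightarrow> complex) set"
  assumes subgroup: "subgroup G Homeo_plus_S1"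
begin

sublocale H: group Homeo_plus_S1 by (rule group_Homeo_plus_S1)

lemma mem_Bij: "f \<in> G \<Longrightarrow> f \<in> Bij S1"
  and mem_orientation: "f \<in> G \<Longrightarrow> orientation_preserving f"
  using subgroup.subset[OF subgroup] by (auto simp: Homeo_plus_S1_def)

lemma mult_apply:
  "f \<in> G \<Longrightarrow> h \<in> G \<Longrightarrow> (f \<otimes>\<^bsub>Homeo_plus_S1\<^esub> h) (cis t) = f (h (cis t))"
  using mem_Bij by (simp add: Homeo_plus_S1_def BijGroup_def compose_def)

lemma eq_of_cis:
  assumes "f \<in> G" "h \<in> G" "\<And>t. f (cis t) = h (cis t)"
  shows "f = h"
proof (rule extensionalityI)
  show "f \<in> extensional S1" "h \<in> extensional S1" using mem_Bij assms by (auto simp: Bij_def)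
  show "f z = h z" if "z \<in> S1" for z using that assms(3) S1_eq_range_cis by auto
qed

lemma one_apply: "\<one>\<^bsub>Homeo_plus_S1\<^esub> (cis t) = cis t"
  by (simp add: one_Homeo_plus_S1)

lemma lift_id: "is_lift id \<one>\<^bsub>Homeo_plus_S1\<^esub>"
  by (auto simp: is_lift_def one_apply strict_mono_def)

lemma lift_comp:
  assumes "f \<in> G" "h \<in> G" and F: "is_lift F f" and K: "is_lift K h"
  shows "is_lift (F \<circ> K) (f \<otimes>\<^bsub>Homeo_plus_S1\<^esub> h)"
proof -
  have "continuous_on UNIV (F \<circ> K)"
    using F K unfolding is_lift_def by (meson continuous_on_compose continuous_on_subset subset_UNIV)
  then show ?thesis using F K mult_apply[OF assms(1,2)] by (simp add: is_lift_def strict_mono_def)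
qed

lemma lift_inverse:
  assumes f: "f \<in> G" and F: "is_lift F f"
  obtains K where "is_lift K (inv\<^bsub>Homeo_plus_S1\<^esub> f)" "K \<circ> F = id" "F \<circ> K = id"
proof -
  let ?i = "inv\<^bsub>Homeo_plus_S1\<^esub> f"
  have i: "?i \<in> G" using subgroup.m_inv_closed[OF subgroup f] .
  have fc: "f \<in> carrier Homeo_plus_S1" using subgroup.subset[OF subgroup] f by blast
  have "?i (f (cis 0)) = cis 0"
    using mult_apply[OF i f, of 0] one_apply[of 0] unfolding H.l_inv[OF fc] by metis
  then have "?i (cis (F 0)) = cis 0" using F unfolding is_lift_def by metis
  then obtain K where K: "is_lift K ?i" "K (F 0) = 0"
    using lift_through[OF mem_orientation[OF i]] by blast
  have "is_lift (K \<circ> F) \<one>\<^bsub>Homeo_plus_S1\<^esub>" "is_lift (F \<circ> K) \<one>\<^bsub>Homeo_plus_S1\<^esub>"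
    using lift_comp[OF i f K(1) F] lift_comp[OF f i F K(1)] fc by simp_all
  then have "K \<circ> F = id" "F \<circ> K = id"
    using lift_unique[OF _ lift_id, of _ 0] lift_unique[OF _ lift_id, of _ "F 0"] K(2) by simp_all
  then show thesis using that K(1) by blast
qed

lemma lift_fixed_eq_id:
  assumes "is_lift F \<one>\<^bsub>Homeo_plus_S1\<^esub>" "F x = x"
  shows "F = id"
  using lift_unique[OF assms(1) lift_id] assms(2) by simp

lemma comm_group_if_lifts:
  assumes "free_interval_action L I" and "\<And>f. f \<in> G \<Longrightarrow> \<exists>F\<in>L. is_lift F f"
  shows "comm_group (Homeo_plus_S1\<lparr>carrier := G\<rparr>)"
proof (rule group.group_comm_groupI)
  show "group (Homeo_plus_S1\<lparr>carrier := G\<rparr>)"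
    by (rule subgroup.subgroup_is_group[OF subgroup group_Homeo_plus_S1])
  fix f h assume "f \<in> carrier (Homeo_plus_S1\<lparr>carrier := G\<rparr>)" "h \<in> carrier (Homeo_plus_S1\<lparr>carrier := G\<rparr>)"
  then have fh: "f \<in> G" "h \<in> G" by simp_all
  obtain F K where F: "F \<in> L" "is_lift F f" and K: "K \<in> L" "is_lift K h" using assms(2) fh by metis
  have "F \<circ> K = K \<circ> F" using free_interval_action.commute[OF assms(1) F(1) K(1)] .
  then have "F (K t) = K (F t)" for t by (metis comp_apply)
  then have "(f \<otimes>\<^bsub>Homeo_plus_S1\<^esub> h) (cis t) = (h \<otimes>\<^bsub>Homeo_plus_S1\<^esub> f) (cis t)" for t
    using mult_apply fh F(2) K(2) unfolding is_lift_def by metis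
  then have "f \<otimes>\<^bsub>Homeo_plus_S1\<^esub> h = h \<otimes>\<^bsub>Homeo_plus_S1\<^esub> f"
    using eq_of_cis subgroup.m_closed[OF subgroup] fh by blast
  then show "f \<otimes>\<^bsub>Homeo_plus_S1\<lparr>carrier := G\<rparr>\<^esub> h = h \<otimes>\<^bsub>Homeo_plus_S1\<lparr>carrier := G\<rparr>\<^esub> f" by simp
qed

text \<open>
  The lifts of the identity are the translations by multiples of the period, so a lift with a fixed
  point lifts an element with a fixed point and is itself the identity.
\<close>

lemma comm_group_if_free:
  assumes "acts_freely G"
  shows "comm_group (Homeo_plus_S1\<lparr>carrier := G\<rparr>)"
proof (rule comm_group_if_lifts)
  let ?L = "{F. \<exists>f\<in>G. is_lift F f}"
  show "free_interval_action ?L UNIV"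
  proof
    show "id \<in> ?L" using lift_id subgroup.one_closed[OF subgroup] by blast
    show "F \<circ> K \<in> ?L" if "F \<in> ?L" "K \<in> ?L" for F K
      using that lift_comp subgroup.m_closed[OF subgroup] by blast
    show "\<exists>K\<in>?L. K \<circ> F = id \<and> F \<circ> K = id" if F: "F \<in> ?L" for F
    proof -
      obtain f where "f \<in> G" "is_lift F f" using F by blast
      then show ?thesis using lift_inverse subgroup.m_inv_closed[OF subgroup] by blast
    qed
    show "F = id" if F: "F \<in> ?L" "F x = x" for F x
    proof -
      obtain f where f: "f \<in> G" "is_lift F f" using F by blast
      then have "f (cis x) = cis x" using F(2) unfolding is_lift_def by metis
      then have "f = \<one>\<^bsub>Homeo_plus_S1\<^esub>" using assms f(1) unfolding acts_freely_def by fastforce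
      then show ?thesis using lift_fixed_eq_id f F(2) by blast
    qed
  qed (auto simp: is_lift_def)
  show "\<exists>F\<in>?L. is_lift F f" if "f \<in> G" for f
    using that mem_orientation[OF that] unfolding orientation_preserving_def is_lift_def by blast
qed

end


section \<open>Groups whose nontrivial elements fix at most one point\<close>

locale one_fixed_point_group = circle_group +
  assumes one_fixed_point: "\<And>g s t. g \<in> G \<Longrightarrow> g (cis s) = cis s \<Longrightarrow> g (cis t) = cis t \<Longrightarrow>
    cis s \<noteq> cis t \<Longrightarrow> g = \<one>\<^bsub>Homeo_plus_S1\<^esub>"
begin

text \<open>
  Every element has exactly one lift that fixes the angle $a$ of the global fixed point. A further
  fixed point of this lift between $a$ and $a + 2\pi$ would give a second fixed point on the circle.
\<close>

lemma comm_group_if_global_fixed_point: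
  assumes "has_global_fixed_point G"
  shows "comm_group (Homeo_plus_S1\<lparr>carrier := G\<rparr>)"
proof -
  obtain a where a: "\<And>g. g \<in> G \<Longrightarrow> g (cis a) = cis a"
    using assms S1_eq_range_cis unfolding has_global_fixed_point_def by (metis imageE)
  let ?L = "{F. \<exists>f\<in>G. is_lift F f \<and> F a = a}" and ?I = "{a<..<a + 2 * pi}"
  show ?thesis
  proof (rule comm_group_if_lifts)
    show "free_interval_action ?L ?I"
    proof
      show "?I \<noteq> {}" by (simp add: not_le)
      show "id \<in> ?L" using lift_id subgroup.one_closed[OF subgroup] by auto
      show "F \<circ> K \<in> ?L" if "F \<in> ?L" "K \<in> ?L" for F K
        using that lift_comp subgroup.m_closed[OF subgroup] by fastforce
      show "\<exists>K\<in>?L. K \<circ> F = id \<and> F \<circ> K = id" if F: "F \<in> ?L" for F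
      proof -
        obtain f where f: "f \<in> G" "is_lift F f" "F a = a" using F by blast
        obtain K where "is_lift K (inv\<^bsub>Homeo_plus_S1\<^esub> f)" "K \<circ> F = id" "F \<circ> K = id"
          using lift_inverse[OF f(1,2)] by blast
        moreover from this have "K a = a" using f(3) by (metis comp_apply id_apply)
        ultimately show ?thesis using subgroup.m_inv_closed[OF subgroup f(1)] by blast
      qed
      show "continuous_on ?I F" if "F \<in> ?L" for F
        using that unfolding is_lift_def by (blast intro: continuous_on_subset)
      show "F x \<in> ?I" if F: "F \<in> ?L" and x: "x \<in> ?I" for F x
      proof -
        have "strict_mono F" "F a = a" "F (a + 2 * pi) = a + 2 * pi"
          using F unfolding is_lift_def by auto
        then show ?thesis using x by (metis greaterThanLessThan_iff strict_mono_less)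
      qed
      show "F = id" if F: "F \<in> ?L" and x: "x \<in> ?I" "F x = x" for F x
      proof -
        obtain f where f: "f \<in> G" "is_lift F f" using F by blast
        then have "f (cis x) = cis x" using x unfolding is_lift_def by metis
        then have "f = \<one>\<^bsub>Homeo_plus_S1\<^esub>"
          using one_fixed_point[OF f(1) a[OF f(1)]] x cis_neq_cis[of a x] by simp
        then show ?thesis using lift_fixed_eq_id f x by blast
      qed
    qed (auto simp: is_lift_def is_interval_oo)
    show "\<exists>F\<in>?L. is_lift F f" if "f \<in> G" for f
      using lift_through[OF mem_orientation[OF that] a[OF that]] that by blast
  qed
qed

lemma lift_moves_up:
  assumes F: "is_lift F f" and up: "\<And>t. a < t \<Longrightarrow> t < a + 2 * pi \<Longrightarrow> t < F t"
    and t: "cis t \<noteq> cis a"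
  shows "t < F t"
proof -
  obtain k :: int where k: "a \<le> t + of_int k * (2 * pi)" "t + of_int k * (2 * pi) < a + 2 * pi"
    by (rule obtain_translate)
  moreover have "t + of_int k * (2 * pi) \<noteq> a" using t cis_eq_cis_iff by metis
  ultimately show ?thesis using up[of "t + of_int k * (2 * pi)"] lift_translate[OF F, of t k] by simp
qed

text \<open>
  The crossing argument: if $g$ moved the fixed point at $a$ to one at $b$, the lifts of $f$ and of
  $g f g^{-1}$ that fix $a$ and $b$ respectively would agree at two angles less than a period apart,
  one on either side of $b$.
\<close>

lemma fixes_if_moves_up:
  assumes f: "f \<in> G" "f \<noteq> \<one>\<^bsub>Homeo_plus_S1\<^esub>" and F: "is_lift F f" "F a = a"
    and up: "\<And>t. a < t \<Longrightarrow> t < a + 2 * pi \<Longrightarrow> t < F t"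
    and g: "g \<in> G"
  shows "g (cis a) = cis a"
proof (rule ccontr)
  assume move: "g (cis a) \<noteq> cis a"
  obtain b' where "g (cis a) = cis b'"
    using mem_orientation[OF g] unfolding orientation_preserving_def by blast
  moreover obtain k :: int
    where k: "a \<le> b' + of_int k * (2 * pi)" "b' + of_int k * (2 * pi) < a + 2 * pi"
    by (rule obtain_translate)
  \<comment> \<open>The image angle is chosen within the period that starts at \<^term>\<open>a\<close>.\<close>
  define b where "b = b' + of_int k * (2 * pi)"
  ultimately have gb: "g (cis a) = cis b" unfolding b_def using cis_eq_cis_iff by metis
  have b: "a < b" "b < a + 2 * pi" using k gb move unfolding b_def by (auto simp: less_le)
  obtain T where T: "is_lift T g" "T a = b" using lift_through[OF mem_orientation[OF g] gb] by blast
  obtain S where S: "is_lift S (inv\<^bsub>Homeo_plus_S1\<^esub> g)" "S \<circ> T = id" "T \<circ> S = id"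
    using lift_inverse[OF g T(1)] by blast
  have TS: "S (T z) = z" "T (S z) = z" for z using S by (metis comp_apply id_apply)+
  have g': "inv\<^bsub>Homeo_plus_S1\<^esub> g \<in> G" using subgroup.m_inv_closed[OF subgroup g] .
  define h where "h = g \<otimes>\<^bsub>Homeo_plus_S1\<^esub> (f \<otimes>\<^bsub>Homeo_plus_S1\<^esub> inv\<^bsub>Homeo_plus_S1\<^esub> g)"
  define H where "H = T \<circ> (F \<circ> S)"
  have fg: "f \<otimes>\<^bsub>Homeo_plus_S1\<^esub> inv\<^bsub>Homeo_plus_S1\<^esub> g \<in> G"
    using subgroup.m_closed[OF subgroup f(1) g'] .
  have h: "h \<in> G" unfolding h_def using subgroup.m_closed[OF subgroup g fg] .
  have H: "is_lift H h"
    unfolding h_def H_def by (intro lift_comp f F g g' T S fg)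
  have "H b = b" unfolding H_def using TS T(2) F(2) by (metis comp_apply)
  have "a < H a"
  proof -
    have "cis (S a) \<noteq> cis a"
    proof
      assume "cis (S a) = cis a"
      then have "cis (T (S a)) = cis b" using T(1) gb unfolding is_lift_def by metis
      then show False using TS gb move by simp
    qed
    then have "S a < F (S a)" using lift_moves_up[OF F(1) up] by blast
    then have "T (S a) < T (F (S a))" using T(1) unfolding is_lift_def by (simp add: strict_mono_less)
    then show ?thesis unfolding H_def by (simp add: TS)
  qed
  \<comment> \<open>The difference is negative at \<^term>\<open>a\<close>, positive at \<^term>\<open>b\<close>, and negative again one period after \<^term>\<open>a\<close>.\<close>
  let ?D = "\<lambda>t. F t - H t"
  have cD: "continuous_on X ?D" for X
    using F(1) H unfolding is_lift_def
    by (intro continuous_on_diff) (blast intro: continuous_on_subset)+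
  have Da: "?D a < 0" using \<open>a < H a\<close> F(2) by simp
  have Db: "?D b > 0" using up b \<open>H b = b\<close> by simp
  have Da': "?D (a + 2 * pi) < 0" using Da F(1) H unfolding is_lift_def by simp
  obtain s where s: "a \<le> s" "s \<le> b" "?D s = 0"
    using IVT'[of ?D a 0 b] Da Db b cD by force
  obtain t where t: "b \<le> t" "t \<le> a + 2 * pi" "?D t = 0"
    using IVT2'[of ?D "a + 2 * pi" 0 b] Da' Db b cD by force
  have "s \<noteq> a" "s \<noteq> b" "t \<noteq> b" "t \<noteq> a + 2 * pi" using s(3) t(3) Da Db Da' by auto
  then have st: "s < t" "t < s + 2 * pi" using s t by auto
  have agree: "f (cis s) = h (cis s)" "f (cis t) = h (cis t)"
    using s(3) t(3) F(1) H unfolding is_lift_def by simp_all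
  let ?h' = "inv\<^bsub>Homeo_plus_S1\<^esub> h"
  have h': "?h' \<in> G" using subgroup.m_inv_closed[OF subgroup h] .
  have fc: "f \<in> carrier Homeo_plus_S1" and hc: "h \<in> carrier Homeo_plus_S1"
    using subgroup.subset[OF subgroup] f(1) h by blast+
  have "?h' (h (cis u)) = cis u" for u
    using mult_apply[OF h' h, of u] one_apply[of u] unfolding H.l_inv[OF hc] by metis
  then have "(?h' \<otimes>\<^bsub>Homeo_plus_S1\<^esub> f) (cis s) = cis s" "(?h' \<otimes>\<^bsub>Homeo_plus_S1\<^esub> f) (cis t) = cis t"
    using mult_apply[OF h' f(1)] agree by simp_all
  then have "?h' \<otimes>\<^bsub>Homeo_plus_S1\<^esub> f = \<one>\<^bsub>Homeo_plus_S1\<^esub>"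
    using one_fixed_point subgroup.m_closed[OF subgroup h' f(1)] cis_neq_cis[OF st] by blast
  then have "f = h" using fc hc by (metis H.inv_equality H.inv_closed H.inv_inv)
  then have "f (cis b) = cis b" using H \<open>H b = b\<close> unfolding is_lift_def by metis
  moreover have "f (cis a) = cis a" using F unfolding is_lift_def by metis
  ultimately show False using one_fixed_point f cis_neq_cis[OF b] by blast
qed

text \<open>
  If the lift of $f$ moves the points between $a$ and $a + 2\pi$ down, its inverse moves them up, so
  the crossing argument applies to $f$ or to $f^{-1}$.
\<close>

lemma fixed_point_is_global:
  assumes f: "f \<in> G" "f \<noteq> \<one>\<^bsub>Homeo_plus_S1\<^esub>" "f (cis a) = cis a" and g: "g \<in> G"
  shows "g (cis a) = cis a"
proof -
  obtain F where F: "is_lift F f" "F a = a" using lift_through[OF mem_orientation[OF f(1)] f(3)] by blast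
  obtain K where K: "is_lift K (inv\<^bsub>Homeo_plus_S1\<^esub> f)" "K \<circ> F = id" "F \<circ> K = id"
    using lift_inverse[OF f(1) F(1)] by blast
  have Ka: "K a = a" using K(2) F(2) by (metis comp_apply id_apply)
  let ?I = "{a<..<a + 2 * pi}"
  have nofix: "F t \<noteq> t" if "t \<in> ?I" for t
  proof
    assume "F t = t"
    then have "f (cis t) = cis t" using F(1) unfolding is_lift_def by metis
    then show False using one_fixed_point[OF f(1,3)] f(2) that cis_neq_cis[of a t] by auto
  qed
  have cont: "continuous_on X F" for X
    using F(1) continuous_on_subset unfolding is_lift_def by blast
  have "connected ((\<lambda>t. F t - t) ` ?I)"
    by (intro connected_continuous_image continuous_intros cont) auto
  then have int: "is_interval ((\<lambda>t. F t - t) ` ?I)" by (simp add: is_interval_connected_1)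
  have "(\<forall>t\<in>?I. t < F t) \<or> (\<forall>t\<in>?I. F t < t)"
  proof (rule ccontr)
    assume "\<not> ?thesis"
    then obtain x y where "x \<in> ?I" "y \<in> ?I" "F x - x \<le> 0" "F y - y \<ge> 0" by (force simp: not_less)
    then have "0 \<in> (\<lambda>t. F t - t) ` ?I" using int unfolding is_interval_1 by blast
    then show False using nofix by force
  qed
  then show ?thesis
  proof
    assume "\<forall>t\<in>?I. t < F t"
    then show ?thesis using fixes_if_moves_up[OF f(1,2) F _ g] by simp
  next
    assume down: "\<forall>t\<in>?I. F t < t"
    have "t < K t" if "a < t" "t < a + 2 * pi" for t
    proof -
      have "K (F t) < K t" using down that K(1) unfolding is_lift_def by (simp add: strict_mono_less)
      moreover have "K t \<in> ?I"
      proof -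
        have "strict_mono K" "K (a + 2 * pi) = a + 2 * pi"
          using K(1) Ka unfolding is_lift_def by auto
        then show ?thesis using that Ka by (metis greaterThanLessThan_iff strict_mono_less)
      qed
      ultimately show ?thesis using down K by (metis comp_apply id_apply)
    qed
    moreover have "inv\<^bsub>Homeo_plus_S1\<^esub> f \<noteq> \<one>\<^bsub>Homeo_plus_S1\<^esub>"
      using f(1,2) subgroup.subset[OF subgroup] by (metis H.inv_eq_1_iff subsetD)
    ultimately show ?thesis
      using fixes_if_moves_up[OF subgroup.m_inv_closed[OF subgroup f(1)] _ K(1) Ka _ g] by blast
  qed
qed

lemma free_or_global_fixed_point: "acts_freely G \<or> has_global_fixed_point G"
proof (cases "acts_freely G")
  case False
  then obtain f a where "f \<in> G" "f \<noteq> \<one>\<^bsub>Homeo_plus_S1\<^esub>" "f (cis a) = cis a"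
    unfolding acts_freely_def using S1_eq_range_cis by (metis imageE)
  then have "\<forall>g\<in>G. g (cis a) = cis a" using fixed_point_is_global by blast
  moreover have "cis a \<in> S1" by simp
  ultimately show ?thesis unfolding has_global_fixed_point_def by blast
qed simp

end

theorem theorem1p6:
  fixes G :: "(complex \<Rightarrow> complex) set"
  assumes "subgroup G Homeo_plus_S1"
    and "torsion_free (Homeo_plus_S1\<lparr>carrier := G\<rparr>)"
    and "\<forall>g\<in>G. g \<noteq> \<one>\<^bsub>Homeo_plus_S1\<^esub> \<longrightarrow>
           (\<forall>p\<in>S1. \<forall>q\<in>S1. g p = p \<and> g q = q \<longrightarrow> p = q)"
  shows "comm_group (Homeo_plus_S1\<lparr>carrier := G\<rparr>) \<and>
         (acts_freely G \<or> has_global_fixed_point G)"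
proof -
  interpret one_fixed_point_group G
  proof (intro one_fixed_point_group.intro circle_group.intro one_fixed_point_group_axioms.intro)
    show "subgroup G Homeo_plus_S1" by (rule assms(1))
    show "g = \<one>\<^bsub>Homeo_plus_S1\<^esub>"
      if "g \<in> G" "g (cis s) = cis s" "g (cis t) = cis t" "cis s \<noteq> cis t" for g s t
    proof -
      have "cis s \<in> S1" "cis t \<in> S1" by simp_all
      then show ?thesis using assms(3) that by blast
    qed
  qed
  show ?thesis
    using free_or_global_fixed_point comm_group_if_free comm_group_if_global_fixed_point by blast
qed

end
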